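(* Let $\lambda,\beta,\rho_o,P_u,\alpha_L,\alpha_N>0$. In the single-tier mmWave uplink model with truncated channel inversion power control, let $\Pi$ be the transmit power that the typical user needs in order to invert its pathloss, and let $P$ denote the transmit power of a typical active user (i.e. $P$ has the law of $\Pi$ conditioned on $\Pi\le P_u$). Define, for $p>0$, $$\lambda(p)=\frac{2\pi\lambda}{\alpha_L\rho_o^{2/\alpha_L}}p^{\frac{2}{\alpha_L}-1}e^{-\beta\left(\frac{p}{\rho_o}\right)^{1/\alpha_L}}+\frac{2\pi\lambda}{\alpha_N\rho_o^{2/\alpha_N}}p^{\frac{2}{\alpha_N}-1}\left(1-e^{-\beta\left(\frac{p}{\rho_o}\right)^{1/\alpha_N}}\right)$$ and $$\Lambda(p)=\frac{2\pi\lambda}{\beta^2}\left(1-e^{-\beta\left(\frac{p}{\rho_o}\right)^{\frac1{\alpha_L}}}\left(1+\beta\left(\tfrac{p}{\rho_o}\right)^{\frac1{\alpha_L}}\right)\right)+\pi\lambda\left(\frac{p}{\rho_o}\right)^{\frac{2}{\alpha_N}}-\frac{2\pi\lambda}{\beta^2}\left(1-e^{-\beta\left(\frac{p}{\rho_o}\right)^{\frac1{\alpha_N}}}\left(1+\beta\left(\tfrac{p}{\rho_o}\right)^{\frac1{\alpha_N}}\right)\right).$$ Then: (i) $P$ has probability density function $$f_P(p)=\frac{\lambda(p)e^{-\Lambda(p)}}{\int_0^{P_u}\lambda(y)e^{-\Lambda(y)}\,\mathrm dy},\qquad 0\le p\le P_u;$$ (ii) the $\delta$-th moment of the transmit power is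 $\mathbb E[P^\delta]=\int_0^{P_u}p^\delta f_P(p)\,\mathrm dp$; (iii) the truncation outage probability, i.e. the probability $\mathcal O_p=\mathbb P(\Pi>P_u)$ that a user is in outage due to insufficient power, is $\mathcal O_p=e^{-\Lambda(P_u)}$.
   Context: Model. Base stations (BSs) form a homogeneous Poisson point process (PPP) of density $\lambda$ in $\mathbb R^2$; the typical user is at the origin. Each user–BS link of length $r$ is, independently of everything else, line-of-sight (LOS) with probability $e^{-\beta r}$ and non-line-of-sight (NLOS) with probability $1-e^{-\beta r}$. The pathloss of a link of length $r$ is $r^{\alpha}$, with $\alpha=\alpha_L$ if the link is LOS and $\alpha=\alpha_N$ if it is NLOS. The user is served by the BS providing the maximum average received signal, i.e. the one with smallest pathloss. Truncated channel inversion with cutoff threshold $\rho_o$: the user would transmit with power $\Pi=\rho_o\min_{\text{BSs}} r^{\alpha}$, so that the average received power at its serving BS equals $\rho_o$; if $\Pi>P_u$ (the maximum transmit power) the user does not transmit (truncation outage), otherwise it is active. Probability density functions are understood up to Lebesgue-null sets, and moments as elements of $[0,\infty]$. The symbol $\lambda$ alone denotes the BS density, whereas $\lambda(\cdot)$ denotes the function of $p$ in the claim. *)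

theory Defs
  imports "HOL-Probability.Probability"
begin

text \<open>
  A point process on the plane is given by an enumeration \<open>X 0, X 1, \<dots>\<close> of its random points,
  counted with multiplicity. A homogeneous Poisson process of positive density almost surely has
  infinitely many points, so indexing by all natural numbers loses nothing.
\<close>

definition point_count :: "(nat \<Rightarrow> 'w \<Rightarrow> real ^ 2) \<Rightarrow> (real ^ 2) set \<Rightarrow> 'w \<Rightarrow> nat" where
  "point_count X A w = card {n. X n w \<in> A}"

text \<open>
  Local finiteness is required explicitly because \<open>card\<close> is 0 on infinite sets. The Poisson
  probabilities are spelled out because \<open>poisson_pmf\<close> needs a positive rate, whereas null sets
  \<open>A\<close> are allowed here.
\<close>

definition homogeneous_ppp :: "'w measure \<Rightarrow> real \<Rightarrow> (nat \<Rightarrow> 'w \<Rightarrow> real ^ 2) \<Rightarrow> bool" where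
  "homogeneous_ppp M lam X \<longleftrightarrow>
     (\<forall>n. X n \<in> borel_measurable M) \<and>
     (AE w in M. \<forall>B. bounded B \<longrightarrow> finite {n. X n w \<in> B}) \<and>
     (\<forall>A k. A \<in> sets borel \<longrightarrow> bounded A \<longrightarrow>
        measure M {w \<in> space M. point_count X A w = k} =
          (lam * measure lborel A) ^ k / fact k * exp (- (lam * measure lborel A))) \<and>
     (\<forall>(A :: nat \<Rightarrow> (real ^ 2) set) I.
        finite I \<longrightarrow> disjoint_family_on A I \<longrightarrow> (\<forall>i\<in>I. A i \<in> sets borel \<and> bounded (A i)) \<longrightarrow>
        prob_space.indep_vars M (\<lambda>_. count_space UNIV) (\<lambda>i. point_count X (A i)) I)"

text \<open>The sub-\<open>\<sigma>\<close>-algebra generated by the positions of all points.\<close>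

definition positions_algebra :: "'w measure \<Rightarrow> (nat \<Rightarrow> 'w \<Rightarrow> real ^ 2) \<Rightarrow> 'w measure" where
  "positions_algebra M X =
     vimage_algebra (space M) (\<lambda>w n. X n w) (Pi\<^sub>M UNIV (\<lambda>_. borel))"

text \<open>
  Given all positions, the LOS indicators of the links to the origin are independent, and the link
  to \<open>X n\<close> is LOS with probability \<open>exp (- beta * norm (X n))\<close>. This is expressed through the
  conditional joint distribution of finitely many indicators.
\<close>

definition los_marking ::
    "'w measure \<Rightarrow> real \<Rightarrow> (nat \<Rightarrow> 'w \<Rightarrow> real ^ 2) \<Rightarrow> (nat \<Rightarrow> 'w \<Rightarrow> bool) \<Rightarrow> bool" where
  "los_marking M beta X los \<longleftrightarrow>
     (\<forall>n. los n \<in> measurable M (count_space UNIV)) \<and>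
     (\<forall>I s. finite I \<longrightarrow>
        (AE w in M.
           real_cond_exp M (positions_algebra M X)
             (indicator {v \<in> space M. \<forall>i\<in>I. los i v = s i}) w =
           (\<Prod>i\<in>I. if s i then exp (- beta * norm (X i w))
                        else 1 - exp (- beta * norm (X i w)))))"

definition pathloss ::
    "real \<Rightarrow> real \<Rightarrow> (nat \<Rightarrow> 'w \<Rightarrow> real ^ 2) \<Rightarrow> (nat \<Rightarrow> 'w \<Rightarrow> bool) \<Rightarrow> nat \<Rightarrow> 'w \<Rightarrow> real" where
  "pathloss alphaL alphaN X los n w =
     norm (X n w) powr (if los n w then alphaL else alphaN)"

text \<open>
  By local finiteness the infimum is almost surely attained, namely by the serving base station.
\<close>

definition required_power ::
    "real \<Rightarrow> real \<Rightarrow> real \<Rightarrow> (nat \<Rightarrow> 'w \<Rightarrow> real ^ 2) \<Rightarrow> (nat \<Rightarrow> 'w \<Rightarrow> bool) \<Rightarrow> 'w \<Rightarrow> real" where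
  "required_power rho alphaL alphaN X los w = rho * (INF n. pathloss alphaL alphaN X los n w)"

definition intensity :: "real \<Rightarrow> real \<Rightarrow> real \<Rightarrow> real \<Rightarrow> real \<Rightarrow> real \<Rightarrow> real" where
  "intensity lam beta rho alphaL alphaN p =
     2 * pi * lam / (alphaL * rho powr (2 / alphaL)) * p powr (2 / alphaL - 1)
       * exp (- beta * (p / rho) powr (1 / alphaL))
     + 2 * pi * lam / (alphaN * rho powr (2 / alphaN)) * p powr (2 / alphaN - 1)
       * (1 - exp (- beta * (p / rho) powr (1 / alphaN)))"

definition Intensity :: "real \<Rightarrow> real \<Rightarrow> real \<Rightarrow> real \<Rightarrow> real \<Rightarrow> real \<Rightarrow> real" where
  "Intensity lam beta rho alphaL alphaN p =
     2 * pi * lam / beta\<^sup>2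
       * (1 - exp (- beta * (p / rho) powr (1 / alphaL)) * (1 + beta * (p / rho) powr (1 / alphaL)))
     + pi * lam * (p / rho) powr (2 / alphaN)
     - 2 * pi * lam / beta\<^sup>2
       * (1 - exp (- beta * (p / rho) powr (1 / alphaN)) * (1 + beta * (p / rho) powr (1 / alphaN)))"

definition power_pdf :: "real \<Rightarrow> real \<Rightarrow> real \<Rightarrow> real \<Rightarrow> real \<Rightarrow> real \<Rightarrow> real \<Rightarrow> real" where
  "power_pdf lam beta rho Pu alphaL alphaN p =
     (if 0 \<le> p \<and> p \<le> Pu
      then intensity lam beta rho alphaL alphaN p * exp (- Intensity lam beta rho alphaL alphaN p)
           / (LBINT y:{0..Pu}. intensity lam beta rho alphaL alphaN y
                                 * exp (- Intensity lam beta rho alphaL alphaN y))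
      else 0)"

end

theory Submission
  imports Defs
begin

text \<open>
  The required power exceeds \<open>p\<close> iff every link has pathloss above \<open>p / rho\<close>. Averaging over the
  marks given the positions turns the probability of this event into the expectation of
  \<open>\<Prod>n. g (X n)\<close>, where \<open>g x\<close> is the probability that a link to \<open>x\<close> has pathloss above \<open>p / rho\<close>.
  For a Poisson process this expectation is \<open>exp (- lam * \<integral>(1 - g))\<close>: for step functions by
  independence of the counts and the generating function of the Poisson distribution, and in general
  by squeezing \<open>g\<close> between step functions. In polar coordinates the exponent is \<open>Intensity p\<close>, whose
  derivative is \<open>intensity p\<close>. Hence the required power has density
  \<open>intensity p * exp (- Intensity p)\<close>, and conditioning only truncates and normalises it.
\<close>

section \<open>The generating functional of a Poisson process\<close>

text \<open>The weighted probabilities form the exponential series at \<open>c * mu\<close>, scaled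
  by \<open>exp (- mu)\<close>. Spelling out the probabilities admits \<open>mu = 0\<close>, which
  occurs for cells of measure zero.\<close>

lemma (in prob_space) expectation_power_poisson:
  fixes N :: "'a \<Rightarrow> nat"
  assumes [measurable]: "N \<in> measurable M (count_space UNIV)"
    and P: "\<And>k. prob {w \<in> space M. N w = k} = mu ^ k / fact k * exp (- mu)"
    and c: "0 \<le> c" "0 \<le> mu"
  shows "expectation (\<lambda>w. c ^ N w) = exp (- mu * (1 - c))"
proof -
  have sums: "(\<lambda>k. c ^ k * (mu ^ k / fact k * exp (- mu))) sums exp (- mu * (1 - c))"
  proof -
    have "(\<lambda>k. (c * mu) ^ k /\<^sub>R fact k * exp (- mu)) sums (exp (c * mu) * exp (- mu))"
      by (intro sums_mult2 exp_converges)
    then show ?thesis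
      by (simp add: power_mult_distrib divide_inverse exp_add[symmetric] algebra_simps)
  qed
  \<comment> \<open>Split the space by the value of \<open>N\<close>; for nonnegative terms, sum and
    integral may be exchanged at once.\<close>
  have "(\<integral>\<^sup>+w. ennreal (c ^ N w) \<partial>M) =
      (\<integral>\<^sup>+w. (\<Sum>k. ennreal (c ^ k) * indicator {w \<in> space M. N w = k} w) \<partial>M)"
  proof (intro nn_integral_cong)
    fix w assume w: "w \<in> space M"
    have "(\<lambda>k. ennreal (c ^ k) * indicator {w \<in> space M. N w = k} w) sums
        (\<Sum>k\<in>{N w}. ennreal (c ^ k) * indicator {w \<in> space M. N w = k} w)"
      by (rule sums_finite) auto
    then show "ennreal (c ^ N w) = (\<Sum>k. ennreal (c ^ k) * indicator {w \<in> space M. N w = k} w)"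
      using w by (simp add: sums_iff)
  qed
  also have "\<dots> = (\<Sum>k. \<integral>\<^sup>+w. ennreal (c ^ k) * indicator {w \<in> space M. N w = k} w \<partial>M)"
    by (rule nn_integral_suminf) measurable
  also have "\<dots> = (\<Sum>k. ennreal (c ^ k * (mu ^ k / fact k * exp (- mu))))"
    using c by (simp add: nn_integral_cmult_indicator emeasure_eq_measure P ennreal_mult'[symmetric])
  also have "\<dots> = ennreal (exp (- mu * (1 - c)))"
    using c sums by (intro suminf_ennreal_eq) auto
  finally show ?thesis
    using c by (intro integral_eq_nn_integral[THEN trans]) auto
qed

lemma homogeneous_pppD:
  fixes A' :: "nat \<Rightarrow> (real ^ 2) set"
  assumes "homogeneous_ppp M lam X"
  shows "X n \<in> borel_measurable M"
    and "AE w in M. \<forall>B. bounded B \<longrightarrow> finite {n. X n w \<in> B}"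
    and "A \<in> sets borel \<Longrightarrow> bounded A \<Longrightarrow>
        measure M {w \<in> space M. point_count X A w = k} =
          (lam * measure lborel A) ^ k / fact k * exp (- (lam * measure lborel A))"
    and "finite I \<Longrightarrow> disjoint_family_on A' I \<Longrightarrow> \<forall>i\<in>I. A' i \<in> sets borel \<and> bounded (A' i) \<Longrightarrow>
        prob_space.indep_vars M (\<lambda>_. count_space UNIV) (\<lambda>i. point_count X (A' i)) I"
  using assms unfolding homogeneous_ppp_def by blast+

text \<open>The level sets of \<open>j\<close> cut \<open>B\<close> into at most
  \<open>m + 1\<close> disjoint cells. Grouping the points by cell turns the product into powers of
  the constants \<open>c i\<close>, whose exponents are independent Poisson counts.\<close>

lemma (in prob_space) ppp_generating_functional_step:
  fixes X :: "nat \<Rightarrow> 'a \<Rightarrow> real ^ 2"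
  assumes ppp: "homogeneous_ppp M lam X" and lam: "0 \<le> lam"
    and B[measurable]: "B \<in> sets borel" "bounded B"
    and j[measurable]: "j \<in> measurable borel (count_space UNIV)" and jm: "\<And>x. j x \<le> (m :: nat)"
    and c: "\<And>i. 0 \<le> c i" "\<And>i. c i \<le> (1 :: real)"
  defines "h \<equiv> (\<lambda>x. if x \<in> B then c (j x) else 1)"
  shows "(\<lambda>n. expectation (\<lambda>w. \<Prod>i<n. h (X i w))) \<longlonglongrightarrow> exp (- lam * (LINT x|lborel. 1 - h x))"
proof -
  note [measurable] = homogeneous_pppD(1)[OF ppp]
  have h[measurable]: "h \<in> borel_measurable borel" unfolding h_def by measurable
  have h01: "0 \<le> h x" "h x \<le> 1" for x by (auto simp: h_def c)
  define A where "A i = {x \<in> B. j x = i}" for i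
  have A: "A i \<in> sets borel" "bounded (A i)" "emeasure lborel (A i) < \<infinity>" for i
  proof -
    show *: "A i \<in> sets borel" unfolding A_def by measurable
    show "bounded (A i)" using B(2) by (rule bounded_subset) (auto simp: A_def)
    then show "emeasure lborel (A i) < \<infinity>" by (rule emeasure_bounded_finite)
  qed
  have disj: "disjoint_family_on A {..m}" by (auto simp: disjoint_family_on_def A_def)
  have indep: "indep_vars (\<lambda>_. count_space UNIV) (\<lambda>i. point_count X (A i)) {..m}"
    using homogeneous_pppD(4)[OF ppp _ disj] A by auto
  then have pc[measurable]: "i \<le> m \<Longrightarrow> point_count X (A i) \<in> measurable M (count_space UNIV)" for i
    by (auto simp: indep_vars_def)
  \<comment> \<open>The eventual value of the products: points outside \<open>B\<close> contribute
    the factor 1, and each point in the cell \<open>A i\<close> contributes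
    \<open>c i\<close>.\<close>
  define W where "W w = (\<Prod>i\<le>m. c i ^ point_count X (A i) w)" for w
  have [measurable]: "W \<in> borel_measurable M"
    unfolding W_def by measurable
  have "(\<lambda>n. expectation (\<lambda>w. \<Prod>i<n. h (X i w))) \<longlonglongrightarrow> expectation W"
  proof (rule integral_dominated_convergence)
    show "AE w in M. (\<lambda>n. \<Prod>i<n. h (X i w)) \<longlonglongrightarrow> W w"
      using homogeneous_pppD(2)[OF ppp]
    proof eventually_elim
      case (elim w)
      define S where "S = {n. X n w \<in> B}"
      have S: "finite S" using elim B(2) by (simp add: S_def)
      have "(\<Prod>i\<in>S. h (X i w)) = (\<Prod>i\<in>(\<Union>k\<in>{..m}. {n. X n w \<in> A k}). h (X i w))"
        by (rule prod.cong) (auto simp: S_def A_def jm)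
      also have "\<dots> = (\<Prod>k\<in>{..m}. \<Prod>i\<in>{n. X n w \<in> A k}. h (X i w))"
      proof (rule prod.UNION_disjoint)
        show "\<forall>k\<in>{..m}. finite {n. X n w \<in> A k}"
          using S by (auto simp: A_def S_def elim!: finite_subset[rotated])
      qed (auto simp: A_def)
      also have "\<dots> = (\<Prod>k\<in>{..m}. \<Prod>i\<in>{n. X n w \<in> A k}. c k)"
        by (intro prod.cong) (auto simp: A_def h_def)
      also have "\<dots> = W w"
        by (simp add: W_def point_count_def)
      finally have W: "(\<Prod>i\<in>S. h (X i w)) = W w" .
      \<comment> \<open>By local finiteness only finitely many indices have their point in
        \<open>B\<close>; beyond the largest of them every factor is 1, so the products are
        eventually constant.\<close>
      obtain k where k: "S \<subseteq> {..<k}"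
        using S by (auto simp: finite_nat_iff_bounded)
      have "(\<Prod>i<n. h (X i w)) = W w" if "k \<le> n" for n
        unfolding W[symmetric] using k that
        by (intro prod.mono_neutral_right) (auto simp: S_def h_def)
      then show ?case
        by (intro tendsto_eventually) (auto simp: eventually_sequentially)
    qed
    show "AE w in M. norm (\<Prod>i<n. h (X i w)) \<le> 1" for n
      using h01 by (auto simp: abs_prod intro!: prod_le_1)
  qed auto
  also have "expectation W = (\<Prod>i\<le>m. expectation (\<lambda>w. c i ^ point_count X (A i) w))"
    unfolding W_def
  proof (rule indep_vars_lebesgue_integral)
    show "indep_vars (\<lambda>_. borel) (\<lambda>i w. c i ^ point_count X (A i) w) {..m}"
      by (rule indep_vars_compose2[OF indep]) auto
    show "integrable M (\<lambda>w. c i ^ point_count X (A i) w)" if "i \<in> {..m}" for i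
      using that c by (intro integrable_const_bound[of _ 1]) (auto simp: power_le_one)
  qed auto
  also have "\<dots> = (\<Prod>i\<le>m. exp (- (lam * measure lborel (A i)) * (1 - c i)))"
    using lam c A homogeneous_pppD(3)[OF ppp] by (intro prod.cong expectation_power_poisson) auto
  also have "\<dots> = exp (- lam * (\<Sum>i\<le>m. (1 - c i) * measure lborel (A i)))"
    by (simp add: exp_sum[symmetric] sum_distrib_left sum_negf mult_ac)
  also have "(\<Sum>i\<le>m. (1 - c i) * measure lborel (A i)) =
      (LINT x|lborel. (\<Sum>i\<le>m. (1 - c i) * indicator (A i) x))"
    using A by (subst Bochner_Integration.integral_sum) auto
  also have "\<dots> = (LINT x|lborel. 1 - h x)"
  proof (intro Bochner_Integration.integral_cong refl)
    fix x
    show "(\<Sum>i\<le>m. (1 - c i) * indicator (A i) x) = 1 - h x"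
    proof (cases "x \<in> B")
      case True
      then have "(\<Sum>i\<le>m. (1 - c i) * indicator (A i) x) = (\<Sum>i\<le>m. if i = j x then 1 - c i else 0)"
        by (intro sum.cong) (auto simp: A_def)
      then show ?thesis using True jm[of x] by (simp add: h_def)
    qed (simp add: h_def A_def)
  qed
  finally show ?thesis .
qed

text \<open>Rounding \<open>g\<close> on \<open>B\<close> down and up to multiples of
  \<open>1 / Suc k\<close> gives step functions on either side. Their integrals differ from that of
  \<open>g\<close> by at most \<open>measure lborel B / Suc k\<close>, which is finite because
  \<open>B\<close> is bounded and vanishes as \<open>k\<close> grows.\<close>

lemma (in prob_space) ppp_generating_functional:
  fixes X :: "nat \<Rightarrow> 'a \<Rightarrow> real ^ 2"
  assumes ppp: "homogeneous_ppp M lam X" and lam: "0 \<le> lam"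
    and B[measurable]: "B \<in> sets borel" "bounded B"
    and g[measurable]: "g \<in> borel_measurable borel"
    and g01: "\<And>x. 0 \<le> g x" "\<And>x. g x \<le> (1 :: real)" and gB: "\<And>x. x \<notin> B \<Longrightarrow> g x = 1"
  shows "(\<lambda>n. expectation (\<lambda>w. \<Prod>i<n. g (X i w))) \<longlonglongrightarrow> exp (- lam * (LINT x|lborel. 1 - g x))"
proof -
  note [measurable] = homogeneous_pppD(1)[OF ppp]
  let ?E = "\<lambda>g n. expectation (\<lambda>w. \<Prod>i<n. g (X i w))"
  let ?I = "LINT x|lborel. 1 - g x" and ?b = "measure lborel B"
  have int: "integrable M (\<lambda>w. \<Prod>i<n. f (X i w))"
    if [measurable]: "f \<in> borel_measurable borel" and "\<And>x. 0 \<le> f x" "\<And>x. f x \<le> 1" for f :: "real ^ 2 \<Rightarrow> real" and n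
    using that by (intro integrable_const_bound[of _ 1]) (auto simp: abs_prod intro!: prod_le_1)
  have mono: "?E f n \<le> ?E f' n"
    if [measurable]: "f \<in> borel_measurable borel" "f' \<in> borel_measurable borel"
      and "\<And>x. 0 \<le> f x" "\<And>x. f x \<le> f' x" "\<And>x. f' x \<le> 1" for f f' :: "real ^ 2 \<Rightarrow> real" and n
  proof -
    have f1: "f x \<le> 1" and f'0: "0 \<le> f' x" for x
      using that(3,4,5)[of x] by linarith+
    show ?thesis
      using that f1 f'0 by (intro integral_mono int prod_mono) auto
  qed
  have Bfin: "emeasure lborel B < \<infinity>" by (rule emeasure_bounded_finite) fact
  have intB: "integrable lborel f" if [measurable]: "f \<in> borel_measurable borel"
    and "\<And>x. 0 \<le> f x" "\<And>x. f x \<le> 1" "\<And>x. x \<notin> B \<Longrightarrow> f x = 0" for f :: "real ^ 2 \<Rightarrow> real"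
  proof (rule Bochner_Integration.integrable_bound)
    show "integrable lborel (indicator B :: _ \<Rightarrow> real)" using Bfin by simp
    have "\<bar>f x\<bar> \<le> \<bar>indicator B x\<bar>" for x
      using that(2,3,4)[of x] by (cases "x \<in> B") auto
    then show "AE x in lborel. norm (f x) \<le> norm (indicator B x :: real)"
      by simp
  qed measurable
  \<comment> \<open>The factors lie in the unit interval, so the expectations decrease and have a
    limit \<open>L\<close>. It remains to locate \<open>L\<close> between the limits for the step
    functions.\<close>
  have "decseq (?E g)"
    using g01 by (intro decseq_SucI integral_mono int) (auto intro!: mult_left_le prod_nonneg)
  moreover have "0 \<le> ?E g n" for n
    using g01 by (intro integral_nonneg_AE AE_I2 prod_nonneg) auto
  ultimately obtain L where L: "?E g \<longlonglongrightarrow> L"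
    using decseq_convergent[of "?E g" 0] by blast
  have bounds: "exp (- lam * (?I + ?b / Suc k)) \<le> L \<and> L \<le> exp (- lam * (?I - ?b / Suc k))" for k
  proof -
    define j where "j x = nat \<lfloor>real (Suc k) * g x\<rfloor>" for x
    \<comment> \<open>Lower and upper grid values for the level \<open>j x\<close>. Capping at 1
      keeps \<open>c\<close> and \<open>d\<close> in the unit interval at every index; for
      \<open>d\<close> the cap takes effect where \<open>g x = 1\<close>.\<close>
    define c where "c i = min 1 (real i / real (Suc k))" for i
    define d where "d i = min 1 (real (Suc i) / real (Suc k))" for i
    define lo where "lo = (\<lambda>x. if x \<in> B then c (j x) else 1)"
    define hi where "hi = (\<lambda>x. if x \<in> B then d (j x) else 1)"
    have j[measurable]: "j \<in> measurable borel (count_space UNIV)"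
      unfolding j_def by measurable
    have [measurable]: "lo \<in> borel_measurable borel" "hi \<in> borel_measurable borel"
      unfolding lo_def hi_def by measurable
    have j_bounds: "real (j x) \<le> Suc k * g x" "Suc k * g x \<le> real (Suc (j x))" for x
      using g01[of x] unfolding j_def by (auto simp: le_nat_iff) linarith+
    have jm: "j x \<le> Suc k" for x
    proof -
      have "real (Suc k) * g x \<le> real (Suc k) * 1"
        by (intro mult_left_mono g01) simp
      with j_bounds(1)[of x] have "real (j x) \<le> real (Suc k)"
        by (metis mult_1_right order_trans)
      then show ?thesis by simp
    qed
    have q: "real (j x) / Suc k \<le> g x" "g x \<le> real (Suc (j x)) / Suc k" for x
      using j_bounds[of x] by (auto simp: field_simps)
    have s: "real (Suc (j x)) / Suc k = real (j x) / Suc k + 1 / Suc k" for x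
      by (simp add: field_simps)
    have c_j: "c (j x) = real (j x) / Suc k" for x
      using order_trans[OF q(1) g01(2), of x] by (simp only: c_def min.absorb2)
    have d_j: "d (j x) = min 1 (real (j x) / Suc k + 1 / Suc k)" for x
      by (simp only: d_def s)
    note q' = q(1) q(2)[unfolded s]
    have lo: "0 \<le> lo x" "lo x \<le> g x" "1 - lo x \<le> 1 - g x + indicator B x / Suc k" for x
      using q'[of x] g01[of x] gB[of x] by (auto simp: lo_def c_j)
    have hi: "hi x \<le> 1" "g x \<le> hi x" "1 - g x - indicator B x / Suc k \<le> 1 - hi x" for x
      using q'[of x] g01[of x] gB[of x] by (auto simp: hi_def d_j min_def)
    have lo_lim: "?E lo \<longlonglongrightarrow> exp (- lam * (LINT x|lborel. 1 - lo x))"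
      unfolding lo_def by (rule ppp_generating_functional_step[OF ppp lam B j jm]) (auto simp: c_def)
    have hi_lim: "?E hi \<longlonglongrightarrow> exp (- lam * (LINT x|lborel. 1 - hi x))"
      unfolding hi_def by (rule ppp_generating_functional_step[OF ppp lam B j jm]) (auto simp: d_def)
    have "?E lo n \<le> ?E g n" "?E g n \<le> ?E hi n" for n
      using lo hi g01 by (auto intro!: mono)
    then have L_le: "exp (- lam * (LINT x|lborel. 1 - lo x)) \<le> L" "L \<le> exp (- lam * (LINT x|lborel. 1 - hi x))"
      using LIMSEQ_le[OF lo_lim L] LIMSEQ_le[OF L hi_lim] by auto
    have int_g: "integrable lborel (\<lambda>x. 1 - g x)"
      using g01 gB by (intro intB) auto
    have int_B: "integrable lborel (\<lambda>x. indicator B x / Suc k :: real)"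
      using Bfin by (intro Bochner_Integration.integrable_divide) simp
    have int_lo: "integrable lborel (\<lambda>x. 1 - lo x)"
      using lo(1) order_trans[OF lo(2) g01(2)] by (intro intB) (auto simp: lo_def)
    have int_hi: "integrable lborel (\<lambda>x. 1 - hi x)"
      using hi(1) order_trans[OF g01(1) hi(2)] by (intro intB) (auto simp: hi_def)
    have "(LINT x|lborel. 1 - lo x) \<le> (LINT x|lborel. (1 - g x) + indicator B x / Suc k)"
      by (intro integral_mono int_lo Bochner_Integration.integrable_add int_g int_B lo(3))
    also have "\<dots> = ?I + ?b / Suc k"
      using int_g int_B by simp
    finally have "(LINT x|lborel. 1 - lo x) \<le> ?I + ?b / Suc k" .
    moreover
    have "(LINT x|lborel. (1 - g x) - indicator B x / Suc k) \<le> (LINT x|lborel. 1 - hi x)"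
      by (intro integral_mono int_hi Bochner_Integration.integrable_diff int_g int_B hi(3))
    then have "?I - ?b / Suc k \<le> (LINT x|lborel. 1 - hi x)"
      using int_g int_B by simp
    ultimately have "- lam * (?I + ?b / Suc k) \<le> - lam * (LINT x|lborel. 1 - lo x)"
      and "- lam * (LINT x|lborel. 1 - hi x) \<le> - lam * (?I - ?b / Suc k)"
      using lam by (simp_all only: mult_minus_left neg_le_iff_le mult_left_mono)
    then show ?thesis
      using L_le by (meson exp_le_cancel_iff order_trans)
  qed
  \<comment> \<open>The bounds on \<open>L\<close> hold for every \<open>k\<close>; their error
    terms vanish, so both collapse to the same exponential.\<close>
  have lim: "(\<lambda>k. ?b / real (Suc k)) \<longlonglongrightarrow> 0"
    by (rule LIMSEQ_Suc[OF lim_const_over_n])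
  have "(\<lambda>k. exp (- lam * (?I + ?b / real (Suc k)))) \<longlonglongrightarrow> exp (- lam * (?I + 0))"
    by (intro tendsto_intros lim)
  then have "exp (- lam * ?I) \<le> L"
    using bounds by (intro LIMSEQ_le_const2[of _ _ L]) auto
  moreover have "(\<lambda>k. exp (- lam * (?I - ?b / real (Suc k)))) \<longlonglongrightarrow> exp (- lam * (?I - 0))"
    by (intro tendsto_intros lim)
  then have "L \<le> exp (- lam * ?I)"
    using bounds by (intro LIMSEQ_le_const[of _ _ L]) auto
  ultimately show ?thesis using L by simp
qed

section \<open>Averaging over the line-of-sight marks\<close>

text \<open>Split according to the set \<open>S\<close> of LOS indices. For a fixed pattern the
  factors depend on the positions only, so the indicator of the pattern can be replaced by its
  conditional probability; summing over all \<open>S\<close> gives back a product.\<close>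

lemma (in prob_space) los_marking_expectation_prod:
  fixes X :: "nat \<Rightarrow> 'a \<Rightarrow> real ^ 2"
  assumes X: "\<And>n. X n \<in> borel_measurable M" and los: "los_marking M beta X los"
    and beta: "0 \<le> beta"
    and u[measurable]: "u \<in> borel_measurable borel" "v \<in> borel_measurable borel"
    and u01: "\<And>x. 0 \<le> u x" "\<And>x. u x \<le> (1 :: real)" and v01: "\<And>x. 0 \<le> v x" "\<And>x. v x \<le> (1 :: real)"
    and I: "finite I"
  shows "expectation (\<lambda>w. \<Prod>i\<in>I. if los i w then u (X i w) else v (X i w)) =
    expectation (\<lambda>w. \<Prod>i\<in>I. exp (- beta * norm (X i w)) * u (X i w)
      + (1 - exp (- beta * norm (X i w))) * v (X i w))"
proof -
  let ?F = "positions_algebra M X"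
  note X[measurable]
  have [measurable]: "los n \<in> measurable M (count_space UNIV)" for n
    using los by (simp add: los_marking_def)
  have pos: "(\<lambda>w n. X n w) \<in> measurable M (Pi\<^sub>M UNIV (\<lambda>_. borel))"
    by (intro measurable_PiM_single') (auto simp: extensional_def)
  have "subalgebra M ?F"
    using sets_image_in_sets[OF refl pos]
    by (simp add: subalgebra_def positions_algebra_def)
  then interpret F: sigma_finite_subalgebra M ?F
    by (intro finite_measure_subalgebra_is_sigma_finite finite_measure_subalgebra.intro
        finite_measure_subalgebra_axioms.intro) unfold_locales
  have XF[measurable]: "X n \<in> borel_measurable ?F" for n
  proof -
    have "(\<lambda>w. (\<lambda>w n. X n w) w n) \<in> borel_measurable ?F"
      unfolding positions_algebra_def
      by (rule measurable_compose[OF measurable_vimage_algebra1 measurable_component_singleton])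
        (auto simp: space_PiM extensional_def)
    then show ?thesis by simp
  qed
  define e where "e i w = exp (- beta * norm (X i w))" for i w
  have e01: "0 \<le> e i w" "e i w \<le> 1" for i w
    using beta by (auto simp: e_def)
  have [measurable]: "e i \<in> borel_measurable M" "e i \<in> borel_measurable ?F" for i
    unfolding e_def by measurable
  \<comment> \<open>For the pattern \<open>S\<close>: \<open>Z S\<close> is the value of the
    product, \<open>K S\<close> below is the event that the pattern occurs, and \<open>R S\<close>
    is its conditional probability given the positions.\<close>
  define Z where "Z S w = (\<Prod>i\<in>S. u (X i w)) * (\<Prod>i\<in>I - S. v (X i w))" for S w
  have [measurable]: "Z S \<in> borel_measurable M" "Z S \<in> borel_measurable ?F" for S
    unfolding Z_def by measurable
  have Z01: "0 \<le> Z S w" "Z S w \<le> 1" for S w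
    unfolding Z_def using u01 v01
    by (auto intro!: mult_nonneg_nonneg prod_nonneg mult_le_one prod_le_1)
  define K :: "nat set \<Rightarrow> 'a set" where "K S = {w \<in> space M. \<forall>i\<in>I. los i w = (i \<in> S)}" for S
  have K[measurable]: "K S \<in> sets M" for S
    unfolding K_def using I by measurable
  define R where "R S w = (\<Prod>i\<in>S. e i w) * (\<Prod>i\<in>I - S. 1 - e i w)" for S w
  have [measurable]: "R S \<in> borel_measurable M" for S
    unfolding R_def by measurable
  have R01: "0 \<le> R S w" "R S w \<le> 1" for S w
    unfolding R_def using e01
    by (auto intro!: mult_nonneg_nonneg prod_nonneg mult_le_one prod_le_1)
  have cond: "AE w in M. real_cond_exp M ?F (indicator (K S)) w = R S w" if "S \<subseteq> I" for S
  proof -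
    have "AE w in M. real_cond_exp M ?F (indicator (K S)) w =
        (\<Prod>i\<in>I. if i \<in> S then e i w else 1 - e i w)"
      using los I unfolding los_marking_def K_def e_def by (elim conjE allE[of _ I] allE[of _ "\<lambda>i. i \<in> S"]) simp
    moreover have "(\<Prod>i\<in>I. if i \<in> S then e i w else 1 - e i w) = R S w" for w
      using I that unfolding R_def
      by (subst prod.If_cases) (auto simp: Int_absorb1 Diff_eq)
    ultimately show ?thesis by simp
  qed
  have int1: "integrable M (\<lambda>w. Z S w * indicator (K S) w)" for S
    using Z01 by (intro integrable_const_bound[of _ 1]) (auto split: split_indicator)
  have int2: "integrable M (\<lambda>w. Z S w * R S w)" for S
    using Z01 R01 by (intro integrable_const_bound[of _ 1]) (auto simp: abs_mult intro!: mult_le_one)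
  \<comment> \<open>\<open>Z S\<close> is measurable with respect to the positions, hence can be
    moved inside the conditional expectation.\<close>
  have swap: "expectation (\<lambda>w. Z S w * indicator (K S) w) = expectation (\<lambda>w. Z S w * R S w)"
    if "S \<subseteq> I" for S
  proof -
    have "expectation (\<lambda>w. Z S w * indicator (K S) w) =
        expectation (\<lambda>w. Z S w * real_cond_exp M ?F (indicator (K S)) w)"
      by (rule F.real_cond_exp_intg(2)[symmetric]) (use int1 in auto)
    also have "\<dots> = expectation (\<lambda>w. Z S w * R S w)"
      using cond[OF that] by (intro integral_cong_AE) auto
    finally show ?thesis .
  qed
  \<comment> \<open>Exactly one pattern occurs at \<open>w\<close>, so a single summand
    survives.\<close>
  have ind: "(\<Prod>i\<in>I. if los i w then u (X i w) else v (X i w)) = (\<Sum>S\<in>Pow I. Z S w * indicator (K S) w)"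
    if w: "w \<in> space M" for w
  proof -
    let ?S = "{i \<in> I. los i w}"
    have "(\<Sum>S\<in>Pow I. Z S w * indicator (K S) w) = (\<Sum>S\<in>Pow I. if S = ?S then Z S w else 0)"
      using w by (intro sum.cong) (auto simp: K_def split: split_indicator)
    also have "\<dots> = Z ?S w"
      using I by (subst sum.delta) auto
    also have "\<dots> = (\<Prod>i\<in>I. if los i w then u (X i w) else v (X i w))"
      using I unfolding Z_def by (subst prod.If_cases) (auto intro!: arg_cong2[where f = "(*)"] prod.cong)
    finally show ?thesis by simp
  qed
  have "expectation (\<lambda>w. \<Prod>i\<in>I. if los i w then u (X i w) else v (X i w)) =
      expectation (\<lambda>w. \<Sum>S\<in>Pow I. Z S w * indicator (K S) w)"
    using ind by (intro Bochner_Integration.integral_cong) auto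
  also have "\<dots> = (\<Sum>S\<in>Pow I. expectation (\<lambda>w. Z S w * R S w))"
    using int1 swap by (subst Bochner_Integration.integral_sum) auto
  also have "\<dots> = expectation (\<lambda>w. \<Sum>S\<in>Pow I. Z S w * R S w)"
    using int2 by (subst Bochner_Integration.integral_sum) auto
  \<comment> \<open>Read from right to left, this expands a product of two-term sums over all
    subsets of \<open>I\<close>.\<close>
  also have "(\<lambda>w. \<Sum>S\<in>Pow I. Z S w * R S w) =
      (\<lambda>w. \<Prod>i\<in>I. e i w * u (X i w) + (1 - e i w) * v (X i w))"
    using I by (auto simp: prod_add Z_def R_def prod.distrib mult_ac)
  finally show ?thesis unfolding e_def .
qed

section \<open>Radial integrals in the plane\<close>

lemma emeasure_plane_norm_le:
  "emeasure lborel {x :: real ^ 2. norm x \<le> a} = (if a < 0 then 0 else ennreal (pi * a\<^sup>2))"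
proof -
  have "\<not> norm x \<le> a" if "a < 0" for x :: "real ^ 2"
    using that norm_ge_zero[of x] by linarith
  then have "{x :: real ^ 2. norm x \<le> a} = (if a < 0 then {} else cball 0 a)"
    by auto
  then show ?thesis
    by (auto simp: emeasure_cball not_less unit_ball_vol_2)
qed

text \<open>The image of planar Lebesgue measure under \<open>norm\<close> has density
  \<open>2 * pi * r\<close> on the nonnegative half-line: both measures give a half-line
  \<open>{..a}\<close> the area of the disc of radius \<open>a\<close>, and these half-lines are an
  intersection-stable generator.\<close>

lemma nn_integral_radial_plane:
  assumes f: "f \<in> borel_measurable borel"
  shows "(\<integral>\<^sup>+x. f (norm (x :: real ^ 2)) \<partial>lborel) =
    (\<integral>\<^sup>+r. ennreal (2 * pi * r) * indicator {0..} r * f r \<partial>lborel)"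
proof -
  let ?D = "density lborel (\<lambda>r. ennreal (2 * pi * r) * indicator {0..} r)"
  let ?M = "distr lborel borel (norm :: real ^ 2 \<Rightarrow> real)"
  have M: "emeasure ?M {..a} = (if a < 0 then 0 else ennreal (pi * a\<^sup>2))" for a
    using emeasure_plane_norm_le[of a] by (simp add: emeasure_distr vimage_def)
  have D: "emeasure ?D {..a} = (if a < 0 then 0 else ennreal (pi * a\<^sup>2))" for a
  proof -
    have "emeasure ?D {..a} =
        (\<integral>\<^sup>+r. ennreal (2 * pi * r) * indicator {0..a} r \<partial>lborel)"
      by (auto simp: emeasure_density intro!: nn_integral_cong split: split_indicator)
    also have "\<dots> = (if a < 0 then 0 else ennreal (pi * a\<^sup>2))"
    proof (cases "a < 0")
      case False
      have "(\<integral>\<^sup>+r. ennreal (2 * pi * r) * indicator {0..a} r \<partial>lborel) = ennreal (pi * a\<^sup>2 - pi * 0\<^sup>2)"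
        using False
        by (intro nn_integral_FTC_Icc) (auto intro!: derivative_eq_intros)
      then show ?thesis using False by simp
    qed simp
    finally show ?thesis .
  qed
  have "?M = ?D"
  proof (rule measure_eqI_generator_eq)
    show "Int_stable (range (atMost :: real \<Rightarrow> _))"
      by (auto simp: Int_stable_def)
    show "sets ?M = sigma_sets UNIV (range atMost)" "sets ?D = sigma_sets UNIV (range atMost)"
      by (simp_all add: borel_eq_atMost)
    show "emeasure ?M S = emeasure ?D S" if "S \<in> range atMost" for S
      using that by (auto simp: M D)
    show "range (\<lambda>n::nat. {..real n}) \<subseteq> range atMost" by auto
    show "(\<Union>n::nat. {..real n}) = UNIV" by (auto intro: real_arch_simple)
    show "emeasure ?M {..real n} \<noteq> \<infinity>" for n :: nat by (simp add: M)
  qed simp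
  have "(\<integral>\<^sup>+x. f (norm (x :: real ^ 2)) \<partial>lborel) = (\<integral>\<^sup>+r. f r \<partial>?M)"
    using f by (simp add: nn_integral_distr)
  also have "\<dots> = (\<integral>\<^sup>+r. ennreal (2 * pi * r) * indicator {0..} r * f r \<partial>lborel)"
    unfolding \<open>?M = ?D\<close> using f by (simp add: nn_integral_density)
  finally show ?thesis .
qed

text \<open>Since the polar weight \<open>2 * pi * r\<close> is part of the derivative of
  \<open>F\<close>, the integral over a disc is a difference of values of \<open>F\<close>.\<close>

lemma nn_integral_radial_plane_FTC:
  fixes f F :: "real \<Rightarrow> real"
  assumes [measurable]: "f \<in> borel_measurable borel"
    and f: "\<And>r. 0 \<le> r \<Longrightarrow> 0 \<le> f r"
    and F: "\<And>r. 0 \<le> r \<Longrightarrow> (F has_real_derivative 2 * pi * r * f r) (at r)"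
    and a: "0 \<le> a"
  shows "(\<integral>\<^sup>+x. ennreal (f (norm (x :: real ^ 2)) * indicator {..a} (norm x)) \<partial>lborel) = ennreal (F a - F 0)"
proof -
  have "(\<integral>\<^sup>+x. ennreal (f (norm (x :: real ^ 2)) * indicator {..a} (norm x)) \<partial>lborel) =
      (\<integral>\<^sup>+r. ennreal (2 * pi * r) * indicator {0..} r * ennreal (f r * indicator {..a} r) \<partial>lborel)"
    by (rule nn_integral_radial_plane) measurable
  also have "\<dots> = (\<integral>\<^sup>+r. ennreal (2 * pi * r * f r) * indicator {0..a} r \<partial>lborel)"
    by (intro nn_integral_cong) (auto simp: ennreal_mult' split: split_indicator)
  also have "\<dots> = ennreal (F a - F 0)"
    using f a by (intro nn_integral_FTC_Icc F) auto
  finally show ?thesis .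
qed

text \<open>The integral of \<open>exp (- beta * norm x)\<close> over the disc of radius \<open>r\<close>.\<close>

definition los_area :: "real \<Rightarrow> real \<Rightarrow> real" where
  "los_area beta r = 2 * pi / beta\<^sup>2 * (1 - exp (- beta * r) * (1 + beta * r))"

lemma los_area_0 [simp]: "los_area beta 0 = 0"
  by (simp add: los_area_def)

lemma los_area_deriv:
  assumes "beta \<noteq> 0"
  shows "(los_area beta has_real_derivative 2 * pi * r * exp (- beta * r)) (at r)"
  unfolding los_area_def using assms
  by (auto intro!: derivative_eq_intros simp: field_simps power2_eq_square)

lemma nlos_area_deriv:
  assumes "beta \<noteq> 0"
  shows "((\<lambda>r. pi * r\<^sup>2 - los_area beta r) has_real_derivative
    2 * pi * r * (1 - exp (- beta * r))) (at r)"
  using assms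
  by (auto intro!: derivative_eq_intros los_area_deriv simp: algebra_simps)

text \<open>
  The conditional probability, given its position \<open>x\<close>, that a base station has pathloss above a
  threshold which corresponds to the radius \<open>rL\<close> for LOS and \<open>rN\<close> for NLOS links.
\<close>

definition blocked :: "real \<Rightarrow> real \<Rightarrow> real \<Rightarrow> real ^ 2 \<Rightarrow> real" where
  "blocked beta rL rN x =
     exp (- beta * norm x) * indicator {rL<..} (norm x)
     + (1 - exp (- beta * norm x)) * indicator {rN<..} (norm x)"

text \<open>The complement of \<open>blocked\<close> is the LOS probability on the disc of radius
  \<open>rL\<close> plus the NLOS probability on the disc of radius \<open>rN\<close>; each part has
  a radial antiderivative.\<close>

lemma integral_blocked:
  assumes "0 < beta" "0 \<le> rL" "0 \<le> rN"
  shows "(LINT x|lborel. 1 - blocked beta rL rN x) =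
    los_area beta rL + (pi * rN\<^sup>2 - los_area beta rN)"
proof -
  let ?q = "\<lambda>x :: real ^ 2. exp (- beta * norm x) * indicator {..rL} (norm x)
     + (1 - exp (- beta * norm x)) * indicator {..rN} (norm x)"
  have q: "1 - blocked beta rL rN x = ?q x" for x
    by (auto simp: blocked_def split: split_indicator)
  have dL: "(los_area beta has_real_derivative 2 * pi * r * exp (- beta * r)) (at r)"
    and dN: "((\<lambda>r. pi * r\<^sup>2 - los_area beta r) has_real_derivative
      2 * pi * r * (1 - exp (- beta * r))) (at r)" for r
    by (rule los_area_deriv nlos_area_deriv, use assms in simp)+
  have L: "(\<integral>\<^sup>+x. ennreal (exp (- beta * norm x) * indicator {..rL} (norm (x :: real ^ 2))) \<partial>lborel) = ennreal (los_area beta rL)"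
    using nn_integral_radial_plane_FTC[of "\<lambda>r. exp (- beta * r)" "los_area beta" rL, OF _ _ dL] assms
    by simp
  have N: "(\<integral>\<^sup>+x. ennreal ((1 - exp (- beta * norm x)) * indicator {..rN} (norm (x :: real ^ 2))) \<partial>lborel) = ennreal (pi * rN\<^sup>2 - los_area beta rN)"
    using nn_integral_radial_plane_FTC[of "\<lambda>r. 1 - exp (- beta * r)" "\<lambda>r. pi * r\<^sup>2 - los_area beta r" rN, OF _ _ dN] assms
    by simp
  \<comment> \<open>Adding the two values inside \<open>ennreal\<close> is legitimate only for
    nonnegative numbers. Both functions vanish at 0 and have nonnegative derivative from there
    on.\<close>
  have nonneg: "0 \<le> los_area beta rL" "0 \<le> pi * rN\<^sup>2 - los_area beta rN"
  proof -
    have "los_area beta 0 \<le> los_area beta rL"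
    proof (rule DERIV_nonneg_imp_nondecreasing[where f = "los_area beta"])
      show "\<exists>y. (los_area beta has_real_derivative y) (at r) \<and> 0 \<le> y" if "0 \<le> r" for r
        by (rule exI, rule conjI, rule dL) (use that in simp)
    qed fact
    moreover have "pi * 0\<^sup>2 - los_area beta 0 \<le> pi * rN\<^sup>2 - los_area beta rN"
    proof (rule DERIV_nonneg_imp_nondecreasing[where f = "\<lambda>r. pi * r\<^sup>2 - los_area beta r"])
      show "\<exists>y. ((\<lambda>r. pi * r\<^sup>2 - los_area beta r) has_real_derivative y) (at r) \<and> 0 \<le> y"
        if "0 \<le> r" for r
        by (rule exI, rule conjI, rule dN) (use that assms in simp)
    qed fact
    ultimately show "0 \<le> los_area beta rL" "0 \<le> pi * rN\<^sup>2 - los_area beta rN" by auto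
  qed
  have "(\<integral>\<^sup>+x. ennreal (?q x) \<partial>lborel) =
      (\<integral>\<^sup>+x. ennreal (exp (- beta * norm x) * indicator {..rL} (norm (x :: real ^ 2)))
        + ennreal ((1 - exp (- beta * norm x)) * indicator {..rN} (norm (x :: real ^ 2))) \<partial>lborel)"
    using assms by (intro nn_integral_cong ennreal_plus) auto
  also have "\<dots> = ennreal (los_area beta rL) + ennreal (pi * rN\<^sup>2 - los_area beta rN)"
    unfolding L[symmetric] N[symmetric] by (intro nn_integral_add) measurable
  also have "\<dots> = ennreal (los_area beta rL + (pi * rN\<^sup>2 - los_area beta rN))"
    using nonneg by simp
  finally have "integral\<^sup>L lborel ?q = los_area beta rL + (pi * rN\<^sup>2 - los_area beta rN)"
    using nonneg assms by (intro integral_eq_nn_integral[THEN trans]) (auto simp: simp del: ennreal_plus)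
  then show ?thesis unfolding q .
qed

section \<open>The exponent as a function of the power\<close>

text \<open>A pathloss of at most \<open>p / rho\<close> means a distance of at most
  \<open>(p / rho) powr (1 / alpha)\<close> for the exponent of the link. With these radii the
  right-hand side is \<open>lam\<close> times the value in \<open>integral_blocked\<close>, the mean
  number of base stations with pathloss at most \<open>p / rho\<close>.\<close>

lemma Intensity_eq:
  assumes "rho > 0" "0 \<le> p"
  shows "Intensity lam beta rho alphaL alphaN p =
    lam * (los_area beta ((p / rho) powr (1 / alphaL))
      + (pi * ((p / rho) powr (1 / alphaN))\<^sup>2 - los_area beta ((p / rho) powr (1 / alphaN))))"
proof -
  have "((p / rho) powr (1 / alphaN))\<^sup>2 = (p / rho) powr (2 / alphaN)"
    by (simp add: power2_eq_square powr_add[symmetric])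
  then show ?thesis
    by (simp add: Intensity_def los_area_def algebra_simps)
qed

text \<open>Covers the endpoint 0, where differentiability can fail: \<open>intensity\<close> is
  unbounded near 0 when, for instance, \<open>alphaL > 2\<close>.\<close>

lemma continuous_on_Intensity:
  assumes "rho > 0" "alphaL > 0" "alphaN > 0"
  shows "continuous_on {0..} (Intensity lam beta rho alphaL alphaN)"
proof -
  have powr: "continuous_on {0..} (\<lambda>p. (p / rho) powr c)" if "c > 0" for c
  proof (rule continuous_on_powr')
    show "continuous_on {0..} (\<lambda>p. p / rho)"
      using assms by (intro continuous_intros) auto
  qed (use assms that in auto)
  have "continuous_on {0..} (\<lambda>p. (p / rho) powr (1 / a))" "continuous_on {0..} (\<lambda>p. (p / rho) powr (2 / a))"
    if "a > 0" for a
    using that by (auto intro!: powr)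
  then show ?thesis
    unfolding Intensity_def using assms
    by (intro continuous_on_add continuous_on_diff continuous_on_mult continuous_on_exp continuous_on_const) auto
qed

text \<open>Chain rule: the derivative of each area with respect to its radius, times the derivative
  of the radius with respect to \<open>p\<close>.\<close>

lemma Intensity_deriv:
  assumes "beta > 0" "rho > 0" "alphaL > 0" "alphaN > 0" "p > 0"
  shows "(Intensity lam beta rho alphaL alphaN has_real_derivative
    intensity lam beta rho alphaL alphaN p) (at p)"
proof -
  have d: "((\<lambda>p. (p / rho) powr (1 / a)) has_real_derivative
      1 / a * p powr (1 / a - 1) / rho powr (1 / a)) (at p)" if "a > 0" for a
  proof -
    have "((\<lambda>p. p powr (1 / a) / rho powr (1 / a)) has_real_derivative
      1 / a * p powr (1 / a - 1) / rho powr (1 / a)) (at p)"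
      using assms that by (auto intro!: derivative_eq_intros)
    then show ?thesis
      by (rule has_field_derivative_transform_within_open[of _ _ _ "{0<..}"])
        (use assms in \<open>auto simp: powr_divide\<close>)
  qed
  \<comment> \<open>Radius times its derivative merges the powers of \<open>p\<close> and of
    \<open>rho\<close>; \<open>E\<close> stands for the LOS or the NLOS probability.\<close>
  have m: "2 * pi * (p / rho) powr (1 / a) * E * (1 / a * p powr (1 / a - 1) / rho powr (1 / a))
     = 2 * pi / (a * rho powr (2 / a)) * p powr (2 / a - 1) * E" if "a > 0" for a E
  proof -
    have p: "p powr (1 / a) * p powr (1 / a - 1) = p powr (2 / a - 1)"
      by (simp add: powr_add[symmetric])
    have rho: "rho powr (1 / a) * rho powr (1 / a) = rho powr (2 / a)"
      by (simp add: powr_add[symmetric])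
    have "2 * pi * (P / R) * E * (1 / a * Q / R) = 2 * pi / (a * (R * R)) * (P * Q) * E" for P Q R :: real
      by (simp add: ac_simps)
    then have "2 * pi * (p / rho) powr (1 / a) * E * (1 / a * p powr (1 / a - 1) / rho powr (1 / a))
      = 2 * pi / (a * (rho powr (1 / a) * rho powr (1 / a))) * (p powr (1 / a) * p powr (1 / a - 1)) * E"
      using assms by (simp only: powr_divide less_imp_le)
    then show ?thesis
      unfolding p rho .
  qed
  let ?L = "\<lambda>p. (p / rho) powr (1 / alphaL)" and ?N = "\<lambda>p. (p / rho) powr (1 / alphaN)"
  have dL: "((\<lambda>p. los_area beta (?L p)) has_real_derivative
      2 * pi * ?L p * exp (- beta * ?L p) * (1 / alphaL * p powr (1 / alphaL - 1) / rho powr (1 / alphaL))) (at p)"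
    using assms by (intro DERIV_chain2[OF los_area_deriv d]) auto
  have dN: "((\<lambda>p. pi * (?N p)\<^sup>2 - los_area beta (?N p)) has_real_derivative
      2 * pi * ?N p * (1 - exp (- beta * ?N p)) * (1 / alphaN * p powr (1 / alphaN - 1) / rho powr (1 / alphaN))) (at p)"
    using assms by (intro DERIV_chain2[OF nlos_area_deriv d]) auto
  have "((\<lambda>p. lam * (los_area beta (?L p) + (pi * (?N p)\<^sup>2 - los_area beta (?N p)))) has_real_derivative
     lam * (2 * pi * ?L p * exp (- beta * ?L p) * (1 / alphaL * p powr (1 / alphaL - 1) / rho powr (1 / alphaL))
     + 2 * pi * ?N p * (1 - exp (- beta * ?N p)) * (1 / alphaN * p powr (1 / alphaN - 1) / rho powr (1 / alphaN)))) (at p)"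
    by (intro DERIV_cmult DERIV_add dL dN)
  also have "lam * (2 * pi * ?L p * exp (- beta * ?L p) * (1 / alphaL * p powr (1 / alphaL - 1) / rho powr (1 / alphaL))
     + 2 * pi * ?N p * (1 - exp (- beta * ?N p)) * (1 / alphaN * p powr (1 / alphaN - 1) / rho powr (1 / alphaN)))
    = intensity lam beta rho alphaL alphaN p"
    unfolding m[OF \<open>alphaL > 0\<close>] m[OF \<open>alphaN > 0\<close>] intensity_def
    unfolding distrib_left by (simp add: ac_simps)
  finally show ?thesis
    \<comment> \<open>\<open>Intensity_eq\<close> is available for \<open>0 \<le> p\<close> only, so
      the derivative is transferred on an open neighbourhood of \<open>p\<close> inside the positive
      half-line.\<close>
    by (rule has_field_derivative_transform_within_open[of _ _ _ "{0<..}"])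
      (use assms in \<open>auto simp: Intensity_eq\<close>)
qed

lemma intensity_nonneg:
  assumes "lam > 0" "beta > 0" "rho > 0" "alphaL > 0" "alphaN > 0"
  shows "0 \<le> intensity lam beta rho alphaL alphaN p"
  using assms by (auto simp: intensity_def intro!: add_nonneg_nonneg mult_nonneg_nonneg)

lemma Intensity_0 [simp]: "Intensity lam beta rho alphaL alphaN 0 = 0"
  by (simp add: Intensity_def)

text \<open>The integrand is the derivative of \<open>- exp (- Intensity p)\<close> in the interior,
  and continuity takes care of the endpoint 0.\<close>

lemma nn_integral_intensity:
  assumes "lam > 0" "beta > 0" "rho > 0" "alphaL > 0" "alphaN > 0" and a: "0 \<le> a"
  shows "(\<integral>\<^sup>+p. ennreal (intensity lam beta rho alphaL alphaN p * exp (- Intensity lam beta rho alphaL alphaN p))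
      * indicator {0..a} p \<partial>lborel) = ennreal (1 - exp (- Intensity lam beta rho alphaL alphaN a))"
proof -
  let ?f = "\<lambda>p. intensity lam beta rho alphaL alphaN p * exp (- Intensity lam beta rho alphaL alphaN p)"
  let ?F = "\<lambda>p. - exp (- Intensity lam beta rho alphaL alphaN p)"
  have "(?f has_integral (?F a - ?F 0)) {0..a}"
  proof (rule fundamental_theorem_of_calculus_interior)
    show "continuous_on {0..a} ?F"
      using assms by (intro continuous_intros continuous_on_subset[OF continuous_on_Intensity]) auto
    show "(?F has_vector_derivative ?f p) (at p)" if "p \<in> {0<..<a}" for p
      unfolding has_real_derivative_iff_has_vector_derivative[symmetric] using assms that
      by (auto intro!: derivative_eq_intros Intensity_deriv)
  qed fact
  then have "(\<integral>\<^sup>+p. ennreal (indicator {0..a} p * ?f p) \<partial>lborel) = ennreal (?F a - ?F 0)"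
    using assms by (intro nn_integral_has_integral_lebesgue) (auto simp: intensity_nonneg)
  moreover have "ennreal (indicator {0..a} p * ?f p) = ennreal (?f p) * indicator {0..a} p" for p
    by (auto split: split_indicator)
  ultimately show ?thesis by simp
qed

text \<open>Ensures that the event of being active has positive probability, so that conditioning
  and normalising do not divide by zero.\<close>

lemma Intensity_pos:
  assumes "lam > 0" "beta > 0" "rho > 0" "alphaL > 0" "alphaN > 0" and a: "0 < a"
  shows "0 < Intensity lam beta rho alphaL alphaN a"
proof -
  have "Intensity lam beta rho alphaL alphaN 0 < Intensity lam beta rho alphaL alphaN a"
  proof (rule DERIV_pos_imp_increasing_open[OF a])
    show "\<exists>y. (Intensity lam beta rho alphaL alphaN has_real_derivative y) (at p) \<and> 0 < y"
      if "0 < p" for p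
    proof -
      have "0 < intensity lam beta rho alphaL alphaN p"
        using assms that unfolding intensity_def by (intro add_pos_pos mult_pos_pos divide_pos_pos) auto
      then show ?thesis
        using Intensity_deriv[OF assms(2-5) that] by blast
    qed
    show "continuous_on {0..a} (Intensity lam beta rho alphaL alphaN)"
      using assms by (intro continuous_on_subset[OF continuous_on_Intensity]) auto
  qed
  then show ?thesis by simp
qed

section \<open>The distribution of the required power\<close>

text \<open>Converts a threshold on the pathloss into one on the distance, since the powers
  \<open>a\<close> and \<open>1 / a\<close> are inverse increasing maps of the nonnegative
  reals.\<close>

lemma less_powr_iff:
  fixes s x a :: real
  assumes "0 < a" "0 \<le> s" "0 \<le> x"
  shows "s < x powr a \<longleftrightarrow> s powr (1 / a) < x"
proof -
  have *: "(y powr (1 / a)) powr a = y" if "0 \<le> y" for y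
    using assms that by (simp add: powr_powr)
  show ?thesis
    using powr_less_mono2[of a "s powr (1 / a)" x] powr_mono2[of a x "s powr (1 / a)"] assms *[of s]
    by (smt (verit) powr_ge_zero)
qed

lemma blocked_bounds:
  assumes "0 \<le> beta"
  shows "0 \<le> blocked beta rL rN x" "blocked beta rL rN x \<le> 1"
  using assms by (auto simp: blocked_def split: split_indicator)

lemma borel_measurable_blocked [measurable]: "blocked beta rL rN \<in> borel_measurable borel"
  unfolding blocked_def by measurable

text \<open>The events for the first \<open>n\<close> base stations decrease to the event for all of
  them. Averaging over the marks expresses each probability by a product of \<open>blocked\<close>
  values, whose limit is given by the generating functional.\<close>

lemma (in prob_space) prob_all_pathloss_greater:
  assumes ppp: "homogeneous_ppp M lam X" and los: "los_marking M beta X los"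
    and pos: "0 < lam" "0 < beta" "0 < alphaL" "0 < alphaN" and s: "0 \<le> s"
  defines "rL \<equiv> s powr (1 / alphaL)" and "rN \<equiv> s powr (1 / alphaN)"
  shows "prob {w \<in> space M. \<forall>n. s < pathloss alphaL alphaN X los n w} =
    exp (- lam * (los_area beta rL + (pi * rN\<^sup>2 - los_area beta rN)))"
proof -
  note [measurable] = homogeneous_pppD(1)[OF ppp]
  have [measurable]: "los n \<in> measurable M (count_space UNIV)" for n
    using los by (simp add: los_marking_def)
  have [measurable]: "pathloss alphaL alphaN X los n \<in> borel_measurable M" for n
    unfolding pathloss_def by measurable
  define D where "D n = {w \<in> space M. \<forall>i<n. s < pathloss alphaL alphaN X los i w}" for n :: nat
  have D: "range D \<subseteq> sets M" "decseq D"
    unfolding D_def by (auto simp: decseq_def)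
  have "(\<lambda>n. prob (D n)) \<longlonglongrightarrow> prob (\<Inter>n. D n)"
    by (rule finite_Lim_measure_decseq) fact+
  also have "(\<Inter>n. D n) = {w \<in> space M. \<forall>n. s < pathloss alphaL alphaN X los n w}"
    by (auto simp: D_def)
  finally have lim: "(\<lambda>n. prob (D n)) \<longlonglongrightarrow> prob {w \<in> space M. \<forall>n. s < pathloss alphaL alphaN X los n w}" .
  let ?u = "\<lambda>r x :: real ^ 2. indicator {r<..} (norm x) :: real"
  have "prob (D n) = expectation (\<lambda>w. \<Prod>i<n. blocked beta rL rN (X i w))" for n
  proof -
    have ind: "indicator (D n) w = (\<Prod>i<n. if los i w then ?u rL (X i w) else ?u rN (X i w))"
      if "w \<in> space M" for w
    proof -
      have "(if los i w then ?u rL (X i w) else ?u rN (X i w)) =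
          of_bool (s < pathloss alphaL alphaN X los i w)" for i
        using pos s by (auto simp: pathloss_def rL_def rN_def less_powr_iff)
      moreover have "(\<Prod>i<n. of_bool (s < pathloss alphaL alphaN X los i w) :: real) =
          of_bool (\<forall>i<n. s < pathloss alphaL alphaN X los i w)"
        by (cases "\<forall>i<n. s < pathloss alphaL alphaN X los i w") (auto intro!: prod_zero)
      ultimately show ?thesis
        using that by (simp add: D_def indicator_def)
    qed
    have "prob (D n) = expectation (indicator (D n))"
      using D by simp
    also have "\<dots> = expectation (\<lambda>w. \<Prod>i<n. if los i w then ?u rL (X i w) else ?u rN (X i w))"
      using ind by (intro Bochner_Integration.integral_cong) auto
    also have "\<dots> = expectation (\<lambda>w. \<Prod>i<n. blocked beta rL rN (X i w))"
      unfolding blocked_def using pos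
      by (intro los_marking_expectation_prod[OF _ los]) auto
    finally show ?thesis .
  qed
  moreover have "(\<lambda>n. expectation (\<lambda>w. \<Prod>i<n. blocked beta rL rN (X i w)))
      \<longlonglongrightarrow> exp (- lam * (LINT x|lborel. 1 - blocked beta rL rN x))"
    \<comment> \<open>Outside the disc of radius \<open>max rL rN\<close> both indicators are 1 and
      the two mark probabilities add up to 1, so \<open>blocked\<close> differs from 1 on a bounded
      set only.\<close>
    using pos
    by (intro ppp_generating_functional[OF ppp, of "cball 0 (max rL rN)"] blocked_bounds)
      (auto simp: blocked_def split: split_indicator)
  ultimately have "(\<lambda>n. prob (D n)) \<longlonglongrightarrow> exp (- lam * (LINT x|lborel. 1 - blocked beta rL rN x))"
    by simp
  from LIMSEQ_unique[OF lim this] show ?thesis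
    using pos by (simp add: integral_blocked rL_def rN_def)
qed

text \<open>A strict bound on every term could degenerate to equality for the infimum. Local
  finiteness excludes this: only finitely many links have pathloss at most
  \<open>s + 1\<close>.\<close>

lemma less_INF_pathloss_iff:
  assumes fin: "\<And>B. bounded B \<Longrightarrow> finite {n. X n w \<in> B}"
    and pos: "0 < alphaL" "0 < alphaN" and s: "0 \<le> s"
  shows "s < (INF n. pathloss alphaL alphaN X los n w) \<longleftrightarrow> (\<forall>n. s < pathloss alphaL alphaN X los n w)"
    (is "s < (INF n. ?p n) \<longleftrightarrow> _")
proof
  have bdd: "bdd_below (range ?p)"
    by (intro bdd_belowI[of _ 0]) (auto simp: pathloss_def)
  show "\<forall>n. s < ?p n" if "s < (INF n. ?p n)"
  proof
    fix n
    show "s < ?p n"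
      using that cINF_lower[OF bdd, of n] by simp
  qed
  assume *: "\<forall>n. s < ?p n"
  define F where "F = {n. ?p n \<le> s + 1}"
  define R where "R = max ((s + 1) powr (1 / alphaL)) ((s + 1) powr (1 / alphaN))"
  have "F \<subseteq> {n. X n w \<in> cball 0 R}"
  proof
    fix n assume "n \<in> F"
    then have "\<not> s + 1 < norm (X n w) powr (if los n w then alphaL else alphaN)"
      by (simp add: F_def pathloss_def)
    then show "n \<in> {n. X n w \<in> cball 0 R}"
      using pos s by (auto simp: less_powr_iff R_def not_less split: if_splits)
  qed
  then have "finite F"
    by (rule finite_subset) (rule fin, simp)
  \<comment> \<open>A lower bound for all links: the finite minimum handles those in
    \<open>F\<close>, and \<open>s + 1\<close> those outside, also when \<open>F\<close> is
    empty.\<close>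
  define m where "m = Min (insert (s + 1) (?p ` F))"
  have "s < m"
    using \<open>finite F\<close> * by (simp add: m_def)
  moreover have "m \<le> (INF n. ?p n)"
  proof (rule cINF_greatest)
    show "m \<le> ?p n" for n
    proof (cases "n \<in> F")
      case True
      then show ?thesis using \<open>finite F\<close> by (simp add: m_def)
    next
      case False
      have "m \<le> s + 1"
        using \<open>finite F\<close> by (simp add: m_def)
      with False show ?thesis by (simp add: F_def)
    qed
  qed simp
  ultimately show "s < (INF n. ?p n)" by simp
qed

lemma (in prob_space) borel_measurable_required_power:
  assumes "homogeneous_ppp M lam X" "los_marking M beta X los"
  shows "required_power rho alphaL alphaN X los \<in> borel_measurable M"
proof -
  note [measurable] = homogeneous_pppD(1)[OF assms(1)]
  have [measurable]: "los n \<in> measurable M (count_space UNIV)" for n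
    using assms(2) by (simp add: los_marking_def)
  show ?thesis
    unfolding required_power_def pathloss_def by measurable
qed

text \<open>After division by \<open>rho\<close> the two events agree almost surely, namely wherever
  the points are locally finite.\<close>

lemma (in prob_space) prob_required_power_greater:
  assumes ppp: "homogeneous_ppp M lam X" and los: "los_marking M beta X los"
    and pos: "0 < lam" "0 < beta" "0 < rho" "0 < alphaL" "0 < alphaN" and p: "0 \<le> p"
  shows "prob {w \<in> space M. p < required_power rho alphaL alphaN X los w} =
    exp (- Intensity lam beta rho alphaL alphaN p)"
proof -
  note [measurable] = homogeneous_pppD(1)[OF ppp] borel_measurable_required_power[OF ppp los]
  have [measurable]: "los n \<in> measurable M (count_space UNIV)" for n
    using los by (simp add: los_marking_def)
  have [measurable]: "pathloss alphaL alphaN X los n \<in> borel_measurable M" for n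
    unfolding pathloss_def by measurable
  have "prob {w \<in> space M. p < required_power rho alphaL alphaN X los w} =
      prob {w \<in> space M. \<forall>n. p / rho < pathloss alphaL alphaN X los n w}"
  proof (rule measure_eq_AE)
    show "AE w in M. w \<in> {w \<in> space M. p < required_power rho alphaL alphaN X los w} \<longleftrightarrow>
        w \<in> {w \<in> space M. \<forall>n. p / rho < pathloss alphaL alphaN X los n w}"
      using homogeneous_pppD(2)[OF ppp]
    proof eventually_elim
      case (elim w)
      have "p < required_power rho alphaL alphaN X los w \<longleftrightarrow>
          p / rho < (INF n. pathloss alphaL alphaN X los n w)"
        using pos by (simp add: required_power_def divide_less_eq mult.commute)
      also have "\<dots> \<longleftrightarrow> (\<forall>n. p / rho < pathloss alphaL alphaN X los n w)"
        by (rule less_INF_pathloss_iff) (use elim pos p in auto)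
      finally show ?case by simp
    qed
  qed measurable
  also have "\<dots> = exp (- Intensity lam beta rho alphaL alphaN p)"
    using prob_all_pathloss_greater[OF ppp los, of alphaL alphaN "p / rho"] pos p
    by (simp add: Intensity_eq)
  finally show ?thesis .
qed

section \<open>Density, moments and outage of the transmit power\<close>

lemma borel_measurable_intensity [measurable]:
  "intensity lam beta rho alphaL alphaN \<in> borel_measurable borel"
  unfolding intensity_def by measurable

lemma borel_measurable_Intensity [measurable]:
  "Intensity lam beta rho alphaL alphaN \<in> borel_measurable borel"
  unfolding Intensity_def by measurable

text \<open>The normalising integral has the closed form found in
  \<open>nn_integral_intensity\<close>; the indicator form is the one that can be integrated
  directly.\<close>

lemma power_pdf_eq:
  assumes "lam > 0" "beta > 0" "rho > 0" "Pu > 0" "alphaL > 0" "alphaN > 0"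
  shows "power_pdf lam beta rho Pu alphaL alphaN p =
    intensity lam beta rho alphaL alphaN p * exp (- Intensity lam beta rho alphaL alphaN p)
      * indicator {0..Pu} p / (1 - exp (- Intensity lam beta rho alphaL alphaN Pu))"
proof -
  have "(LBINT y:{0..Pu}. intensity lam beta rho alphaL alphaN y * exp (- Intensity lam beta rho alphaL alphaN y))
      = 1 - exp (- Intensity lam beta rho alphaL alphaN Pu)"
    unfolding set_lebesgue_integral_def
    using nn_integral_intensity[of lam beta rho alphaL alphaN Pu] Intensity_pos[of lam beta rho alphaL alphaN Pu] assms
    by (intro integral_eq_nn_integral[THEN trans])
      (auto simp: intensity_nonneg ennreal_indicator[symmetric] ennreal_mult'[symmetric] mult.commute)
  then show ?thesis
    by (simp add: power_pdf_def)
qed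

theorem theorem1:
  fixes lam beta rho Pu alphaL alphaN :: real
    and M :: "'w measure"
    and X :: "nat \<Rightarrow> 'w \<Rightarrow> real ^ 2"
    and los :: "nat \<Rightarrow> 'w \<Rightarrow> bool"
    and N :: "'v measure"
    and P :: "'v \<Rightarrow> real"
  defines "Pi_req \<equiv> required_power rho alphaL alphaN X los"
    and "f_P \<equiv> power_pdf lam beta rho Pu alphaL alphaN"
  assumes "lam > 0" "beta > 0" "rho > 0" "Pu > 0" "alphaL > 0" "alphaN > 0"
    and "prob_space M"
    and "homogeneous_ppp M lam X"
    and "los_marking M beta X los"
    and "prob_space N"
    and "P \<in> borel_measurable N"
    and "distr N borel P = distr (uniform_measure M {w \<in> space M. Pi_req w \<le> Pu}) borel Pi_req"
  shows "distributed N lborel P (\<lambda>p. ennreal (f_P p)) \<and>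
    (\<forall>delta :: real.
       (\<integral>\<^sup>+ v. ennreal (P v powr delta) \<partial>N) =
       (\<integral>\<^sup>+ p\<in>{0..Pu}. ennreal (p powr delta * f_P p) \<partial>lborel)) \<and>
    measure M {w \<in> space M. Pi_req w > Pu} =
      exp (- Intensity lam beta rho alphaL alphaN Pu)"
proof -
  interpret prob_space M by fact
  let ?L = "Intensity lam beta rho alphaL alphaN"
  let ?h = "\<lambda>p. intensity lam beta rho alphaL alphaN p * exp (- ?L p)"
  define Z where "Z = 1 - exp (- ?L Pu)"
  note pos = \<open>lam > 0\<close> \<open>beta > 0\<close> \<open>rho > 0\<close> \<open>alphaL > 0\<close> \<open>alphaN > 0\<close>
  note [measurable] = \<open>P \<in> borel_measurable N\<close>
  have Z: "0 < Z"
    using Intensity_pos[OF pos \<open>Pu > 0\<close>] by (simp add: Z_def)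
  have f_P: "f_P p = ?h p * indicator {0..Pu} p / Z" for p
    unfolding f_P_def Z_def using \<open>Pu > 0\<close> pos by (simp add: power_pdf_eq)
  have f_P_nonneg: "0 \<le> f_P p" for p
    using Z by (simp add: f_P intensity_nonneg[OF pos])
  have [measurable]: "f_P \<in> borel_measurable borel"
    unfolding f_P by measurable
  have Pi_meas[measurable]: "Pi_req \<in> borel_measurable M"
    unfolding Pi_req_def by (rule borel_measurable_required_power) fact+
  have greater: "prob {w \<in> space M. Pi_req w > a} = exp (- ?L a)" if "0 \<le> a" for a
    unfolding Pi_req_def by (rule prob_required_power_greater) fact+
  have le: "prob {w \<in> space M. Pi_req w \<le> a} = 1 - exp (- ?L a)" if "0 \<le> a" for a
  proof -
    have "prob {w \<in> space M. Pi_req w \<le> a} = prob (space M - {w \<in> space M. Pi_req w > a})"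
      by (intro arg_cong[of _ _ prob]) auto
    also have "\<dots> = 1 - exp (- ?L a)"
      using that by (subst prob_compl) (auto simp: greater)
    finally show ?thesis .
  qed
  \<comment> \<open>Monotonicity reduces this to the threshold 0, where the probability vanishes
    because \<open>Intensity\<close> is 0 there.\<close>
  have le_neg: "prob {w \<in> space M. Pi_req w \<le> a} = 0" if "a < 0" for a
  proof -
    have "prob {w \<in> space M. Pi_req w \<le> a} \<le> prob {w \<in> space M. Pi_req w \<le> 0}"
      using that by (intro finite_measure_mono) auto
    then show ?thesis by (simp add: le measure_le_0_iff)
  qed
  \<comment> \<open>The distribution function of \<open>P\<close>: the conditional probability that
    the required power is at most \<open>a\<close>, constant 1 from \<open>Pu\<close> on.\<close>
  define G where "G a = (if a < 0 then 0 else (1 - exp (- ?L (min a Pu))) / Z)" for a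
  have dist: "distributed N lborel P (\<lambda>p. ennreal (f_P p))"
  proof (rule distributedI_borel_atMost)
    show "(\<integral>\<^sup>+x. ennreal (f_P x * indicator {..a} x) \<partial>lborel) = ennreal (G a)" for a
    proof (cases "a < 0")
      case True
      then have zero: "f_P x * indicator {..a} x = 0" for x
        by (auto simp: f_P split: split_indicator)
      show ?thesis using True by (simp add: zero G_def)
    next
      case False
      have "ennreal (f_P x * indicator {..a} x) = ennreal (1 / Z) * (ennreal (?h x) * indicator {0..min a Pu} x)" for x
        using Z by (auto simp: f_P ennreal_mult'[symmetric] split: split_indicator)
      then have "(\<integral>\<^sup>+x. ennreal (f_P x * indicator {..a} x) \<partial>lborel) =
          ennreal (1 / Z) * ennreal (1 - exp (- ?L (min a Pu)))"
        using nn_integral_intensity[OF pos, of "min a Pu"] False \<open>Pu > 0\<close>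
        by (simp add: nn_integral_cmult)
      then show ?thesis
        using False Z by (simp add: G_def ennreal_mult'[symmetric])
    qed
    show "emeasure N {x \<in> space N. P x \<le> a} = ennreal (G a)" for a
    proof -
      have "emeasure N {x \<in> space N. P x \<le> a} = emeasure (distr N borel P) {..a}"
        by (auto simp: emeasure_distr intro!: arg_cong[of _ _ "emeasure N"])
      \<comment> \<open>Only the law of \<open>P\<close> is prescribed, so its distribution function
        is computed on the conditioned space of \<open>Pi_req\<close>.\<close>
      also have "\<dots> = emeasure (uniform_measure M {w \<in> space M. Pi_req w \<le> Pu}) {w \<in> space M. Pi_req w \<le> a}"
        unfolding \<open>distr N borel P = _\<close>
        by (subst emeasure_distr) (auto simp: vimage_def Int_def conj_commute)
      also have "\<dots> = emeasure M {w \<in> space M. Pi_req w \<le> min a Pu} / emeasure M {w \<in> space M. Pi_req w \<le> Pu}"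
        by (subst emeasure_uniform_measure)
          (auto intro!: arg_cong2[where f = "(/)"] arg_cong[of _ _ "emeasure M"])
      \<comment> \<open>The denominator is \<open>Z\<close>; for negative \<open>a\<close> the
        numerator is 0 by \<open>le_neg\<close>.\<close>
      also have "\<dots> = ennreal (G a)"
        using Z \<open>Pu > 0\<close> le[of "min a Pu"] le[of Pu] le_neg[of "min a Pu"]
        by (auto simp: G_def emeasure_eq_measure divide_ennreal Z_def simp del: min.bounded_iff)
      finally show ?thesis .
    qed
  qed (auto simp: f_P_nonneg)
  moreover have "(\<integral>\<^sup>+ v. ennreal (P v powr delta) \<partial>N) =
      (\<integral>\<^sup>+ p\<in>{0..Pu}. ennreal (p powr delta * f_P p) \<partial>lborel)" for delta
  proof -
    \<comment> \<open>The density vanishes off \<open>{0..Pu}\<close>, so restricting the domain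
      changes nothing. Working with nonnegative integrals covers every real \<open>delta\<close>,
      including infinite moments; the value of \<open>powr\<close> at 0 concerns a single point, a
      null set.\<close>
    have outside: "f_P p = 0" if "p \<notin> {0..Pu}" for p
      using that by (simp add: f_P)
    have "(\<integral>\<^sup>+ v. ennreal (P v powr delta) \<partial>N) = (\<integral>\<^sup>+ p. ennreal (f_P p) * ennreal (p powr delta) \<partial>lborel)"
      by (rule distributed_nn_integral[OF dist, symmetric]) measurable
    also have "\<dots> = (\<integral>\<^sup>+ p\<in>{0..Pu}. ennreal (p powr delta * f_P p) \<partial>lborel)"
      by (intro nn_integral_cong)
        (auto simp: f_P_nonneg outside ennreal_mult mult.commute split: split_indicator)
    finally show ?thesis .
  qed
  ultimately show ?thesis
    using greater[of Pu] \<open>Pu > 0\<close> by simp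
qed

end
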